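(* For integers $p,q\ge1$ and $a,b\ge0$ with $a\le q$ and $a+b\le p+1$, \begin{align*} &(-1)^{a+b}S^{(r)}_{[\,p+1\,|\,q+b-1\,]}(X)\,S^{(r-1)}_{[\,p-1\,|\,q-a\,]^{p-a-b+1}}(X)\\ &=S^{(r)}_{[\,p\,|\,q+b-1\,]}(X)\,S^{(r-1)}_{[\,p\,|\,q-a+1\,]}(X)-S^{(r)}_{[\,p\,|\,q-a\,]}(X)\,S^{(r-1)}_{[\,p\,|\,q+b\,]}(X)\\ &\quad+\sum_{t=0}^{a+b-3}(-1)^{t-1}S^{(r)}_{[\,p\,|\,q+b-1\,]_{q-a+t+1}}(X)\,S^{(r-1)}_{[\,p-1\,|\,q-a\,]^{p-t-1}}(X). \end{align*}
   Context: $[\,p\,|\,q\,]$ denotes the rectangular partition $(q^p)$; $[\,p\,|\,q\,]^{l}_{k}=((q+1)^l,q^{p-l},k)$, $[\,p\,|\,q\,]^l=[\,p\,|\,q\,]^l_0$, $[\,p\,|\,q\,]_k=[\,p\,|\,q\,]^0_k$. Let $N$ be a positive integer and $X=[x_{i,j}]_{1\le i,j\le N}$ a matrix of indeterminates; over $\mathbb{C}(X)$ write the Gauss decomposition $X=X_-X_0X_+$ ($X_-$ lower unitriangular, $X_0$ diagonal, $X_+$ upper unitriangular). For $0\le r\le N$ and a partition $\lambda\subset((N-r)^r)$, $S^{(r)}_\lambda(X)$ is the minor of $X_+$ with rows $\{1,\ldots,r\}$ and columns $\{\lambda_{r+1-a}+a:1\le a\le r\}$; $S^{(r)}_\varnothing=1$,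 and $S^{(r)}_\lambda=0$ if $\lambda$ is not a partition. $N$ is assumed large enough that everything is defined.
   Formalization: The case a=b=0 is excluded: there the partition on the left, [p-1|q]^{p+1}, has a negative exponent, and with S=0 for non-partitions the identity fails (p=q=1, r=2: 0 versus u_13 - u_12 u_23, u the entries of X_+). *)

theory Defs
  imports
    "HOL-Library.Poly_Mapping"
    "HOL-Library.Product_Lexorder"
    "HOL-Computational_Algebra.Fraction_Field"
    "Jordan_Normal_Form.Determinant"
begin

section \<open>The generic matrix\<close>

text \<open>
  Complex polynomials in indeterminates \<open>x_{i,j}\<close>: finitely supported maps from monomials
  (exponent functions) to coefficients. The lexicographic order on pairs is used only to obtain
  the instance of class \<open>idom\<close>, which the fraction field needs.
  Indeterminates are available for all pairs of naturals, so that one field serves all sizes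
  \<open>N\<close>; \<open>\<complex>(X)\<close> for the generic \<open>N \<times> N\<close> matrix is the subfield generated by its entries.
\<close>

type_synonym entry_poly = "(nat \<times> nat \<Rightarrow>\<^sub>0 nat) \<Rightarrow>\<^sub>0 complex"
type_synonym entry_ratfun = "entry_poly fract"

definition indet :: "nat \<Rightarrow> nat \<Rightarrow> entry_ratfun" where
  "indet i j = Fract (Poly_Mapping.single (Poly_Mapping.single (i, j) 1) 1) 1"

text \<open>Matrix indices start at 0, those of the indeterminates at 1.\<close>

definition generic_matrix :: "nat \<Rightarrow> entry_ratfun mat" where
  "generic_matrix N = mat N N (\<lambda>(i, j). indet (i + 1) (j + 1))"

section \<open>Gauss decomposition\<close>

definition lower_unitriangular :: "'a::{zero,one} mat \<Rightarrow> bool" where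
  "lower_unitriangular A \<longleftrightarrow>
     (\<forall>i<dim_row A. A $$ (i, i) = 1 \<and> (\<forall>j<dim_col A. i < j \<longrightarrow> A $$ (i, j) = 0))"

definition upper_unitriangular :: "'a::{zero,one} mat \<Rightarrow> bool" where
  "upper_unitriangular A \<longleftrightarrow>
     (\<forall>i<dim_row A. A $$ (i, i) = 1 \<and> (\<forall>j<dim_col A. j < i \<longrightarrow> A $$ (i, j) = 0))"

definition gauss_decomposition ::
    "nat \<Rightarrow> 'a::field mat \<Rightarrow> 'a mat \<Rightarrow> 'a mat \<Rightarrow> 'a mat \<Rightarrow> bool" where
  "gauss_decomposition N X L D U \<longleftrightarrow>
     L \<in> carrier_mat N N \<and> D \<in> carrier_mat N N \<and> U \<in> carrier_mat N N \<and>
     lower_unitriangular L \<and> diagonal_mat D \<and> upper_unitriangular U \<and>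
     X = L * D * U"

text \<open>
  The factor \<open>X\<^sub>+\<close>. It is determined whenever \<open>X\<close> is square with nonzero leading principal
  minors, as is the case for the generic matrix.
\<close>

definition gauss_upper :: "'a::field mat \<Rightarrow> 'a mat" where
  "gauss_upper X = (THE U. \<exists>L D. gauss_decomposition (dim_row X) X L D U)"

section \<open>Partitions and the functions \<open>S\<close>\<close>

definition is_partition :: "int list \<Rightarrow> bool" where
  "is_partition xs \<longleftrightarrow> sorted_wrt (\<ge>) xs \<and> (\<forall>x\<in>set xs. 0 \<le> x)"

text \<open>
  \<open>rect p q l k\<close> is \<open>[p|q]\<^sup>l\<^sub>k = ((q+1)\<^sup>l, q\<^sup>p\<^sup>-\<^sup>l, k)\<close>. With a negative exponent this expression
  denotes no sequence at all, in particular no partition, and the value is \<open>None\<close>.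
\<close>

definition rect :: "int \<Rightarrow> int \<Rightarrow> int \<Rightarrow> int \<Rightarrow> int list option" where
  "rect p q l k =
     (if 0 \<le> l \<and> l \<le> p
      then Some (replicate (nat l) (q + 1) @ replicate (nat (p - l)) q @ [k])
      else None)"

text \<open>\<open>part xs i\<close> is the \<open>i\<close>-th part, counted from 1; missing parts are 0.\<close>

definition part :: "int list \<Rightarrow> nat \<Rightarrow> nat" where
  "part xs i = (if 1 \<le> i \<and> i \<le> length xs then nat (xs ! (i - 1)) else 0)"

text \<open>
  Shifted to indices from 0, the column \<open>\<lambda>\<^bsub>r+1-a\<^esub> + a\<close> (for \<open>a = 1, \<dots>, r\<close>) becomes
  \<open>part xs (r - j) + j\<close> with \<open>j = a - 1\<close>. These columns increase with \<open>j\<close>. The minor has its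
  intended meaning when the partition is contained in \<open>((N-r)\<^sup>r)\<close>, with \<open>N\<close> the size of \<open>X\<close>.
\<close>

definition S :: "nat \<Rightarrow> int list option \<Rightarrow> 'a::field mat \<Rightarrow> 'a" where
  "S r lam X =
     (case lam of
        None \<Rightarrow> 0
      | Some xs \<Rightarrow>
          (if is_partition xs
           then det (mat r r (\<lambda>(i, j). gauss_upper X $$ (i, part xs (r - j) + j)))
           else 0))"

end

theory Submission
  imports Defs
begin

text \<open>
  A minor with rows \<open>1, \<dots>, r - 1\<close> is a minor with rows \<open>1, \<dots>, r\<close> of the matrix extended by the
  additional column \<open>e\<^sub>r\<close>. In these terms the identity is a single Pluecker exchange relation:
  the \<open>r + 1\<close> columns with indices \<open>1, \<dots>, r - p\<close> and \<open>r + q - a - p + 1, \<dots>, r + q - a\<close> together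
  with \<open>e\<^sub>r\<close> are moved in turn into the one free place among the remaining \<open>r - 1\<close> columns of the
  minor \<open>[p|q+b-1]\<^sub>k\<close>. The relation holds for an arbitrary matrix, so no property
  of \<open>X\<^sub>+\<close> enters.
\<close>

text \<open>The column index comes first, so that \<open>c(m := x)\<close> replaces a column and
  composing with \<open>insert_index m\<close> deletes one.\<close>

definition cols_det :: "nat \<Rightarrow> (nat \<Rightarrow> nat \<Rightarrow> 'a::comm_ring_1) \<Rightarrow> 'a" where
  "cols_det r c = det (mat r r (\<lambda>(i, j). c j i))"

lemma cols_det_cong:
  "(\<And>i j. i < r \<Longrightarrow> j < r \<Longrightarrow> c j i = c' j i) \<Longrightarrow> cols_det r c = cols_det r c'"
  unfolding cols_det_def by (rule arg_cong[of _ _ det]) auto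

lemma cols_det_repeated_column:
  assumes "j < r" "k < r" "j \<noteq> k" "\<And>i. i < r \<Longrightarrow> c j i = c k i"
  shows "cols_det r c = 0"
  unfolding cols_det_def
  by (rule det_identical_columns[OF _ assms(3,1,2)]) (use assms in \<open>auto intro!: eq_vecI\<close>)

text \<open>The cofactors along column \<open>m\<close> do not see that column, so those of
  \<open>c\<close> serve for every \<open>x\<close>. This displays the determinant as a fixed linear
  functional of \<open>x\<close>.\<close>

lemma cols_det_expand_column:
  assumes "m < r"
  shows "cols_det r (c(m := x)) =
    (\<Sum>k<r. x k * cofactor (mat r r (\<lambda>(i, j). c j i)) k m)"
proof -
  let ?B = "mat r r (\<lambda>(i, j). (c(m := x)) j i)"
  have "cofactor ?B k m = cofactor (mat r r (\<lambda>(i, j). c j i)) k m" if "k < r" for k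
    unfolding cofactor_def mat_delete_def by (rule arg_cong[of _ _ "\<lambda>M. _ * det M"]) auto
  then show ?thesis
    unfolding cols_det_def using assms
    by (subst laplace_expansion_column[of _ r m]) auto
qed

lemma cols_det_unit_column:
  assumes "m \<le> n"
  shows "cols_det (Suc n) (c(m := (\<lambda>i. if i = n then 1 else 0))) =
    (-1) ^ (n + m) * cols_det n (\<lambda>j. c (insert_index m j))"
proof -
  let ?C = "mat (Suc n) (Suc n) (\<lambda>(i, j). c j i)"
  have "cols_det (Suc n) (c(m := (\<lambda>i. if i = n then 1 else 0))) =
      (\<Sum>k<Suc n. if k = n then cofactor ?C k m else 0)"
    using assms by (subst cols_det_expand_column) (auto intro!: sum.cong)
  also have "\<dots> = cofactor ?C n m"
    by simp
  also have "mat_delete ?C n m = mat n n (\<lambda>(i, j). c (insert_index m j) i)"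
    unfolding mat_delete_def insert_index_def by auto
  then have "cofactor ?C n m = (-1) ^ (n + m) * cols_det n (\<lambda>j. c (insert_index m j))"
    unfolding cofactor_def cols_det_def by simp
  finally show ?thesis .
qed

text \<open>Cramer's relation among \<open>r + 1\<close> vectors of length \<open>r\<close>, read in
  coordinate \<open>k\<close>: up to sign it is the expansion along the last row of a determinant of
  size \<open>r + 1\<close> whose last row repeats row \<open>k\<close>.\<close>

lemma linear_dependence:
  assumes "k < r"
  shows "(\<Sum>i\<le>r. (-1) ^ i * v i k * cols_det r (\<lambda>j. v (insert_index i j))) = 0"
proof -
  let ?B = "mat (Suc r) (Suc r) (\<lambda>(i, j). v j (if i = r then k else i))"
  have del: "mat_delete ?B r j = mat r r (\<lambda>(i, j'). v (insert_index j j') i)" for j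
    unfolding mat_delete_def insert_index_def by auto
  have "det ?B = (\<Sum>j<Suc r. v j k * ((-1) ^ (r + j) * cols_det r (\<lambda>j'. v (insert_index j j'))))"
    by (subst laplace_expansion_row[of _ "Suc r" r]) (auto simp: cofactor_def del cols_det_def)
  also have "\<dots> = (-1) ^ r * (\<Sum>i\<le>r. (-1) ^ i * v i k * cols_det r (\<lambda>j. v (insert_index i j)))"
    by (simp add: sum_distrib_left lessThan_Suc_atMost power_add mult_ac)
  finally have "det ?B = \<dots>" .
  moreover have "det ?B = 0"
    by (rule det_identical_rows[of _ "Suc r" k r]) (use assms in \<open>auto intro!: eq_vecI\<close>)
  \<comment> \<open>Only ring operations are available, so the sign is cancelled by multiplying with
    it once more.\<close>
  ultimately have "(-1) ^ r * ((-1) ^ r *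
      (\<Sum>i\<le>r. (-1) ^ i * v i k * cols_det r (\<lambda>j. v (insert_index i j)))) = 0"
    by simp
  then show ?thesis
    by (simp add: mult.assoc[symmetric] power_mult_distrib[symmetric])
qed

text \<open>Apply the linear functional "determinant with column \<open>m\<close> left free" to
  Cramer's relation for the vectors \<open>v i\<close>.\<close>

lemma plucker_relation:
  assumes "m < r"
  shows "(\<Sum>i\<le>r. (-1) ^ i * cols_det r (c(m := v i)) * cols_det r (\<lambda>j. v (insert_index i j))) = 0"
proof -
  let ?f = "\<lambda>k. cofactor (mat r r (\<lambda>(i, j). c j i)) k m"
  have "(\<Sum>i\<le>r. (-1) ^ i * cols_det r (c(m := v i)) * cols_det r (\<lambda>j. v (insert_index i j))) =
      (\<Sum>i\<le>r. \<Sum>k<r. ?f k * ((-1) ^ i * v i k * cols_det r (\<lambda>j. v (insert_index i j))))"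
    unfolding cols_det_expand_column[OF assms]
    by (simp add: sum_distrib_left sum_distrib_right mult_ac)
  also have "\<dots> = (\<Sum>k<r. ?f k * (\<Sum>i\<le>r. (-1) ^ i * v i k * cols_det r (\<lambda>j. v (insert_index i j))))"
    by (subst sum.swap) (simp add: sum_distrib_left)
  also have "\<dots> = 0"
    by (simp add: linear_dependence)
  finally show ?thesis .
qed

text \<open>Dictionary: \<open>m\<close>, \<open>d\<close>, \<open>n\<close> are r - p - 1, q - a, a
  + b - 1, and the large size is r. Then \<open>F k\<close> belongs to [p|q+b-1]_k and
  \<open>G t\<close> to [p-1|q-a]^(p-t-1).\<close>

lemma rectangular_minor_relation:
  fixes u :: "nat \<Rightarrow> nat \<Rightarrow> 'a::comm_ring_1" and m n p d :: nat
  assumes "n \<le> p"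
  defines "F \<equiv> \<lambda>k. cols_det (Suc (m + p)) (\<lambda>j i. u i ((if j < m then 0 else if j = m then k else d + n) + j))"
    and "G \<equiv> \<lambda>t. cols_det (m + p) (\<lambda>j i. u i ((if j \<le> m then 0 else if j \<le> m + t then d else Suc d) + j))"
  shows "F 0 * cols_det (m + p) (\<lambda>j i. u i ((if j < m then 0 else Suc d) + j))
      - cols_det (Suc (m + p)) (\<lambda>j i. u i ((if j \<le> m then 0 else d) + j))
        * cols_det (m + p) (\<lambda>j i. u i ((if j < m then 0 else Suc (d + n)) + j))
      = (\<Sum>t<n. (-1) ^ t * F (d + Suc t) * G t)"
proof -
  let ?r = "Suc (m + p)"
  define e :: "nat \<Rightarrow> 'a" where "e = (\<lambda>i. if i = m + p then 1 else 0)"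
  define c where "c = (\<lambda>j i. u i ((if j < m then 0 else d + n) + j))"
  \<comment> \<open>\<open>w\<close> holds the exchanged columns other than \<open>e\<close>;
    \<open>c\<close> holds the fixed ones, its entry at place \<open>m\<close> always being
    overwritten.\<close>
  define w where "w = (\<lambda>j i. u i ((if j \<le> m then 0 else d) + j))"
  define v where "v = w(?r := e)"
  define T where "T = (\<lambda>i. (-1) ^ i * cols_det ?r (c(m := v i)) * cols_det ?r (\<lambda>j. v (insert_index i j)))"
  have F: "cols_det ?r (c(m := w i)) = F k" if "w i = (\<lambda>x. u x (k + m))" for i k
    unfolding F_def by (rule cols_det_cong) (auto simp: c_def that)
  have omit: "cols_det ?r (\<lambda>j. v (insert_index i j)) = cols_det (m + p) (\<lambda>j. w (insert_index i j))"
    if "i \<le> m + p" for i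
  proof -
    \<comment> \<open>Once column \<open>i\<close> is gone, \<open>e\<close> stands at the last
      place \<open>m + p\<close>, where expanding along it gives the sign +1.\<close>
    have "cols_det ?r (\<lambda>j. v (insert_index i j)) = cols_det ?r ((\<lambda>j. w (insert_index i j))(m + p := e))"
      by (rule cols_det_cong) (use that in \<open>auto simp: v_def insert_index_def\<close>)
    also have "\<dots> = cols_det (m + p) (\<lambda>j. w (insert_index i (insert_index (m + p) j)))"
      unfolding e_def by (subst cols_det_unit_column) (auto simp: mult_2[symmetric] power_mult)
    also have "\<dots> = cols_det (m + p) (\<lambda>j. w (insert_index i j))"
      by (rule cols_det_cong) (auto simp: insert_index_def)
    finally show ?thesis .
  qed
  have T_less: "T i = 0" if "i < m" for i
  proof -
    \<comment> \<open>Column \<open>i\<close> of \<open>w\<close> already stands at place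
      \<open>i\<close> of \<open>c\<close>.\<close>
    have "cols_det ?r (c(m := v i)) = 0"
      by (rule cols_det_repeated_column[of i _ m]) (use that in \<open>auto simp: c_def v_def w_def\<close>)
    then show ?thesis by (simp add: T_def)
  qed
  have T_m: "T m = (-1) ^ m * (F 0 * cols_det (m + p) (\<lambda>j i. u i ((if j < m then 0 else Suc d) + j)))"
  proof -
    have "cols_det (m + p) (\<lambda>j. w (insert_index m j)) =
        cols_det (m + p) (\<lambda>j i. u i ((if j < m then 0 else Suc d) + j))"
      by (rule cols_det_cong) (auto simp: w_def insert_index_def)
    moreover have "cols_det ?r (c(m := v m)) = F 0"
      using F[of m 0] by (simp add: v_def w_def)
    ultimately show ?thesis
      by (simp add: T_def omit)
  qed
  have T_t: "T (Suc m + t) = - ((-1) ^ m * ((-1) ^ t * F (d + Suc t) * G t))" if "t < p" for t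
  proof -
    have "cols_det (m + p) (\<lambda>j. w (insert_index (Suc m + t) j)) = G t"
      unfolding G_def by (rule cols_det_cong) (auto simp: w_def insert_index_def)
    moreover have "cols_det ?r (c(m := v (Suc m + t))) = F (d + Suc t)"
      using F[of "Suc m + t" "d + Suc t"] that by (simp add: v_def w_def add_ac)
    ultimately show ?thesis
      using that by (simp add: T_def omit power_add)
  qed
  \<comment> \<open>From \<open>t = n\<close> on, the moved column falls among the columns of
    \<open>c\<close> to the right of the free place; this cuts the sum at \<open>n\<close>.\<close>
  have F_0: "F (d + Suc t) = 0" if "n \<le> t" "t < p" for t
    unfolding F_def
    by (rule cols_det_repeated_column[of m _ "Suc m + (t - n)"]) (use that in \<open>auto simp: add_ac\<close>)
  \<comment> \<open>Here \<open>e\<close> itself is moved, so the factor containing \<open>c\<close>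
    is the one that loses a row.\<close>
  have T_r: "T ?r = - ((-1) ^ m * (cols_det ?r (\<lambda>j i. u i ((if j \<le> m then 0 else d) + j))
        * cols_det (m + p) (\<lambda>j i. u i ((if j < m then 0 else Suc (d + n)) + j))))"
  proof -
    have "cols_det ?r (c(m := v ?r)) = (-1) ^ (m + p + m) * cols_det (m + p) (\<lambda>j. c (insert_index m j))"
      unfolding v_def e_def by (simp add: cols_det_unit_column)
    also have "cols_det (m + p) (\<lambda>j. c (insert_index m j)) =
        cols_det (m + p) (\<lambda>j i. u i ((if j < m then 0 else Suc (d + n)) + j))"
      by (rule cols_det_cong) (auto simp: c_def insert_index_def)
    moreover have "cols_det ?r (\<lambda>j. v (insert_index ?r j)) =
        cols_det ?r (\<lambda>j i. u i ((if j \<le> m then 0 else d) + j))"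
      by (rule cols_det_cong) (auto simp: v_def w_def insert_index_def)
    moreover have "(-1) ^ ?r * ((-1) ^ (m + p + m) * x) = - ((-1) ^ m * x)" for x :: 'a
      by (simp add: power_add mult.assoc[symmetric]) (simp add: mult_ac flip: power_mult_distrib)
    ultimately show ?thesis
      unfolding T_def
      by (simp only: mult.assoc) (simp add: mult_ac)
  qed
  have "(\<Sum>i\<le>?r. T i) = (\<Sum>i<m. T i) + T m + (\<Sum>t<p. T (Suc m + t)) + T ?r"
  proof -
    have "(\<Sum>i<Suc m + p. T i) = (\<Sum>i<Suc m. T i) + (\<Sum>t<p. T (Suc m + t))"
      by (induction p) (simp_all add: add_ac)
    then show ?thesis
      by (simp add: lessThan_Suc_atMost[symmetric] add_ac)
  qed
  also have "(\<Sum>i<m. T i) = 0"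
    by (simp add: T_less)
  also have "(\<Sum>t<p. T (Suc m + t)) = (\<Sum>t<p. - ((-1) ^ m * ((-1) ^ t * F (d + Suc t) * G t)))"
    by (intro sum.cong refl) (simp add: T_t del: add_Suc add_Suc_right)
  also have "\<dots> = - ((-1) ^ m * (\<Sum>t<p. (-1) ^ t * F (d + Suc t) * G t))"
    by (simp add: sum_negf sum_distrib_left)
  also have "(\<Sum>t<p. (-1) ^ t * F (d + Suc t) * G t) = (\<Sum>t<n. (-1) ^ t * F (d + Suc t) * G t)"
    by (rule sum.mono_neutral_right) (use assms F_0 in auto)
  finally have "(\<Sum>i\<le>?r. T i) = (-1) ^ m * (F 0 * cols_det (m + p) (\<lambda>j i. u i ((if j < m then 0 else Suc d) + j))
      - cols_det ?r (\<lambda>j i. u i ((if j \<le> m then 0 else d) + j))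
        * cols_det (m + p) (\<lambda>j i. u i ((if j < m then 0 else Suc (d + n)) + j))
      - (\<Sum>t<n. (-1) ^ t * F (d + Suc t) * G t))" (is "_ = _ * ?R")
    unfolding T_m T_r by (simp add: algebra_simps)
  moreover have "(\<Sum>i\<le>?r. T i) = 0"
    unfolding T_def by (rule plucker_relation) simp
  ultimately have "(-1) ^ m * ((-1) ^ m * ?R) = 0"
    by simp
  then have "?R = 0"
    by (simp only: mult.assoc[symmetric] power_mult_distrib[symmetric]) simp
  then show ?thesis
    by simp
qed

text \<open>Column \<open>j\<close> uses part number \<open>r - j\<close>; the tests locate that
  part in its block, written additively to avoid truncated subtraction. The bound
  \<open>k \<le> q\<close> makes the list weakly decreasing, so the default 0 of \<open>S\<close>
  does not occur.\<close>

lemma S_rect: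
  assumes "l \<le> p" "k \<le> q"
  shows "S r (rect (int p) (int q) (int l) (int k)) X =
    cols_det r (\<lambda>j i. gauss_upper X $$ (i, (if r \<le> l + j then Suc q
      else if r \<le> p + j then q else if r = Suc (p + j) then k else 0) + j))"
proof -
  let ?xs = "replicate l (int q + 1) @ replicate (p - l) (int q) @ [int k]"
  have rect: "rect (int p) (int q) (int l) (int k) = Some ?xs"
    using assms by (simp add: rect_def nat_diff_distrib)
  have partition: "is_partition ?xs"
    using assms by (auto simp: is_partition_def sorted_wrt_iff_nth_less nth_append nth_Cons split: nat.splits)
  have part: "part ?xs (r - j) = (if r \<le> l + j then Suc q
      else if r \<le> p + j then q else if r = Suc (p + j) then k else 0)" if "j < r" for j
    using assms that by (auto simp: part_def nth_append nat_add_distrib nth_Cons split: nat.splits)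
  show ?thesis
    unfolding S_def rect cols_det_def using partition
    by (simp add: part) (rule arg_cong[of _ _ det], auto simp: part)
qed

theorem theorem4p5:
  fixes p q a b :: int and r N :: nat and X :: "entry_ratfun mat"
  assumes "p \<ge> 1" and "q \<ge> 1" and "a \<ge> 0" and "b \<ge> 0"
    and "a \<le> q" and "a + b \<le> p + 1"
    and "a + b \<ge> 1"
    and "p + 1 \<le> int r" and "int r + (q + b - 1) \<le> int N"
  defines "X \<equiv> generic_matrix N"
  shows "(-1) powi (a + b) * S r (rect (p + 1) (q + b - 1) 0 0) X
            * S (r - 1) (rect (p - 1) (q - a) (p - a - b + 1) 0) X
       = S r (rect p (q + b - 1) 0 0) X * S (r - 1) (rect p (q - a + 1) 0 0) X
         - S r (rect p (q - a) 0 0) X * S (r - 1) (rect p (q + b) 0 0) X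
         + (\<Sum>t = 0..a + b - 3. (-1) powi (t - 1)
              * S r (rect p (q + b - 1) 0 (q - a + t + 1)) X
              * S (r - 1) (rect (p - 1) (q - a) (p - t - 1) 0) X)"
proof -
  \<comment> \<open>The hypotheses make all four quantities nonnegative, so the passage to
    \<open>nat\<close> loses nothing; \<open>m\<close> counts the parts beyond the first p + 1, all
    zero.\<close>
  define P where "P = nat p"
  define d where "d = nat (q - a)"
  define n where "n = nat (a + b - 1)"
  define m where "m = r - Suc P"
  have p: "p = int P" and qa: "q - a = int d" and ab: "a + b = int n + 1"
    and n: "n \<le> P" and r: "r = Suc (m + P)" and qb: "q + b - 1 = int (d + n)"
    using assms(1-8) by (auto simp: P_def d_def n_def m_def)
  have qa1: "q - a + 1 = int (Suc d)" and qb1: "q + b = int (Suc (d + n))"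
    using qa qb by auto
  define u where "u = (\<lambda>i k. gauss_upper X $$ (i, k))"
  define F where "F = (\<lambda>k. cols_det (Suc (m + P))
    (\<lambda>j i. u i ((if j < m then 0 else if j = m then k else d + n) + j)))"
  define G where "G = (\<lambda>t. cols_det (m + P)
    (\<lambda>j i. u i ((if j \<le> m then 0 else if j \<le> m + t then d else Suc d) + j)))"
  have F: "S r (rect p (q + b - 1) 0 (int k)) X = F k" if "k \<le> d + n" for k
    unfolding p qb r F_def u_def using S_rect[of 0 P k "d + n" "Suc (m + P)" X] that
    by (auto intro!: cols_det_cong)
  \<comment> \<open>A last part \<open>k\<close> equal to q + b - 1 lengthens the rectangle by one
    row.\<close>
  have F_top: "S r (rect (p + 1) (q + b - 1) 0 0) X = F (d + n)"
    unfolding p qb r F_def u_def using S_rect[of 0 "Suc P" 0 "d + n" "Suc (m + P)" X]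
    by (auto intro!: cols_det_cong simp: add.commute)
  have G: "S (r - 1) (rect (p - 1) (q - a) (p - int t - 1) 0) X = G t" if "t < P" for t
    unfolding p qa r G_def u_def using S_rect[of "P - Suc t" "P - 1" 0 d "m + P" X] that
    by (auto intro!: cols_det_cong simp: of_nat_diff algebra_simps)
  \<comment> \<open>If a + b = 1, the upper index is p, exceeding p - 1; the sequence is then
    undefined and \<open>S\<close> is 0 by convention.\<close>
  have G_last: "S (r - 1) (rect (p - 1) (q - a) (p - a - b + 1) 0) X =
      (if n = 0 then 0 else G (n - 1))"
  proof (cases "n = 0")
    case True
    then show ?thesis
      using ab by (simp add: S_def rect_def)
  next
    case False
    then have "p - a - b + 1 = p - int (n - 1) - 1"
      using ab by (simp add: of_nat_diff)
    then show ?thesis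
      using False n by (simp only: G) simp
  qed
  have A: "S (r - 1) (rect p (q - a + 1) 0 0) X =
      cols_det (m + P) (\<lambda>j i. u i ((if j < m then 0 else Suc d) + j))"
    unfolding p qa1 r u_def using S_rect[of 0 P 0 "Suc d" "m + P" X] by (auto intro!: cols_det_cong)
  have B: "S (r - 1) (rect p (q + b) 0 0) X =
      cols_det (m + P) (\<lambda>j i. u i ((if j < m then 0 else Suc (d + n)) + j))"
    unfolding p qb1 r u_def using S_rect[of 0 P 0 "Suc (d + n)" "m + P" X] by (auto intro!: cols_det_cong)
  have C: "S r (rect p (q - a) 0 0) X =
      cols_det (Suc (m + P)) (\<lambda>j i. u i ((if j \<le> m then 0 else d) + j))"
    unfolding p qa r u_def using S_rect[of 0 P 0 d "Suc (m + P)" X] by (auto intro!: cols_det_cong)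
  have "(\<Sum>t = 0..a + b - 3. (-1) powi (t - 1) * S r (rect p (q + b - 1) 0 (q - a + t + 1)) X
        * S (r - 1) (rect (p - 1) (q - a) (p - t - 1) 0) X)
      = (\<Sum>t<n - 1. - ((-1) ^ t * F (d + Suc t) * G t))"
  proof (rule sum.reindex_bij_witness[of _ int nat])
    fix t :: int
    assume t: "t \<in> {0..a + b - 3}"
    define k where "k = nat t"
    have k: "t = int k" "k < n - 1" "k < P"
      using t ab n by (auto simp: k_def)
    have "q - a + t + 1 = int (d + Suc k)"
      using k(1) qa by simp
    then have "S r (rect p (q + b - 1) 0 (q - a + t + 1)) X = F (d + Suc k)"
      using F[of "d + Suc k"] k(2) by (simp only:)
    \<comment> \<open>At \<open>t = 0\<close> the exponent is -1, hence the integer power.\<close>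
    moreover have "(-1 :: entry_ratfun) powi (t - 1) = - ((-1) ^ k)"
      by (simp add: k(1) power_int_diff)
    ultimately show "- ((-1) ^ nat t * F (d + Suc (nat t)) * G (nat t)) =
        (-1) powi (t - 1) * S r (rect p (q + b - 1) 0 (q - a + t + 1)) X
        * S (r - 1) (rect (p - 1) (q - a) (p - t - 1) 0) X"
      using G[OF k(3)] by (simp add: k(1))
  qed (use ab in auto)
  moreover have "F 0 * S (r - 1) (rect p (q - a + 1) 0 0) X
      - S r (rect p (q - a) 0 0) X * S (r - 1) (rect p (q + b) 0 0) X
      = (\<Sum>t<n. (-1) ^ t * F (d + Suc t) * G t)"
    unfolding A B C F_def G_def by (rule rectangular_minor_relation[OF n])
  moreover have "S r (rect p (q + b - 1) 0 0) X = F 0"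
    using F[of 0] by simp
  \<comment> \<open>The term \<open>t = n - 1\<close> is the left-hand side of the theorem, since n
    - 1 and a + b have the same parity. The remaining terms are the sum in the theorem with opposite
    sign.\<close>
  moreover have "(\<Sum>t<n. (-1) ^ t * F (d + Suc t) * G t) =
      (-1) powi (a + b) * F (d + n) * (if n = 0 then 0 else G (n - 1))
      + (\<Sum>t<n - 1. (-1) ^ t * F (d + Suc t) * G t)"
    unfolding ab by (cases n) (simp_all add: power_int_add)
  ultimately show ?thesis
    unfolding F_top G_last by (simp add: sum_negf)
qed

end
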